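(* Let $(X,\kappa)$ be a digital image. Then: (1) For subsets $A,W\subset X$ such that $Cl_\kappa(W)\subset Int_\kappa(A)$, the inclusion $(X-W,A-W)\to(X,A)$ induces isomorphisms $dH_n(X-W,A-W)\to dH_n(X,A)$ for $n<2$. Equivalently, (2) For subsets $A,B\subset X$ such that $X=Int_\kappa(A)\cup Int_\kappa(B)$, the inclusion $(B,A\cap B)\to(X,A)$ induces isomorphisms $dH_n(B,A\cap B)\to dH_n(X,A)$ for $n<2$.
   Context: A digital image $(X,\kappa)$ is a finite subset $X\subset\mathbb{Z}^d$ ($d\ge 1$) equipped with an adjacency relation $\kappa=c_l$ for some $1\le l\le d$, where distinct points $p,q\in\mathbb{Z}^d$ are $c_l$-adjacent if at most $l$ of their coordinates differ by one unit and all remaining coordinates are equal. Subsets of $X$ are digital images with the same adjacency. A function $f:(X,\kappa)\to(Y,\lambda)$ is $(\kappa,\lambda)$-continuous if whenever $x_0,x_1$ are $\kappa$-adjacent, $f(x_0),f(x_1)$ are equal or $\lambda$-adjacent. $\kappa$-interior and $\kappa$-closure in $X$. For $x\in X$, $N_\kappa(x,X)=\{y\in X: y=x\text{ or }y\text{ is }\kappa\text{-adjacent to }x\}$. For $A\subset X$, $Int_\kappa(A)=\{x\in A: N_\kappa(x,X)\subset A\}$ and $Cl_\kappa(A)=\{x\in X: N_\kappa(x,X)\cap A\ne\emptyset\}$. Cubical singular homology. $I=\{0,1\}\subset\mathbb{Z}$, and $I^n$ carries the $c_1$-adjacency of $\mathbb{Z}^n$ (denoted $2n$); $I^0$ is a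 point. A digital $n$-cube in $(X,\kappa)$ is a $(2n,\kappa)$-continuous map $T:I^n\to X$; it is degenerate if for some $i$, $T(t_1,\dots,t_n)$ does not depend on $t_i$. $dQ_n(X)$ is the free abelian group on digital $n$-cubes, $dD_n(X)$ the subgroup generated by degenerate ones, $dC_n(X)=dQ_n(X)/dD_n(X)$ (zero for $n<0$). Put $A_iT(t_1,\dots,t_{n-1})=T(t_1,\dots,t_{i-1},0,t_i,\dots,t_{n-1})$, $B_iT(t_1,\dots,t_{n-1})=T(t_1,\dots,t_{i-1},1,t_i,\dots,t_{n-1})$, $\partial_n T=\sum_{i=1}^n(-1)^i(A_iT-B_iT)$ (with $\partial_n=0$ for $n\le0$); this induces a boundary map on $dC_\bullet(X)$ with $\partial\partial=0$. For $A\subset X$, $dC_n(A)$ is a subgroup of $dC_n(X)$ preserved by $\partial$; put $dC_n(X,A)=dC_n(X)/dC_n(A)$ with the induced boundary, and let $dH_n(X,A)$ be the $n$-th homology group of $(dC_\bullet(X,A),\partial)$. A map of pairs $f:(X,A)\to(Y,B)$ (continuous, with $f(A)\subset B$) induces $f_*:dH_n(X,A)\to dH_n(Y,B)$ via $T\mapsto f\circ T$. *)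

theory Defs
  imports "HOL-Algebra.Free_Abelian_Groups" "HOL-Algebra.Coset" "HOL-Library.FuncSet"
begin

text \<open>
  A point of \<open>\<int>\<^sup>d\<close> is an integer list of length \<open>d\<close>. Lists are used because the dimension of
  the cubes \<open>I\<^sup>n\<close> has to vary inside the definitions.
\<close>

definition c_adj :: "nat \<Rightarrow> int list \<Rightarrow> int list \<Rightarrow> bool" where
  "c_adj l p q \<longleftrightarrow>
     length p = length q \<and> p \<noteq> q \<and>
     card {i. i < length p \<and> p ! i \<noteq> q ! i} \<le> l \<and>
     (\<forall>i < length p. p ! i \<noteq> q ! i \<longrightarrow> \<bar>p ! i - q ! i\<bar> = 1)"

definition digital_image :: "nat \<Rightarrow> nat \<Rightarrow> int list set \<Rightarrow> bool" where
  "digital_image d l X \<longleftrightarrow>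
     1 \<le> d \<and> 1 \<le> l \<and> l \<le> d \<and> finite X \<and> X \<subseteq> {p. length p = d}"

definition digitally_continuous ::
    "('a \<Rightarrow> 'a \<Rightarrow> bool) \<Rightarrow> ('b \<Rightarrow> 'b \<Rightarrow> bool) \<Rightarrow> 'a set \<Rightarrow> 'b set \<Rightarrow> ('a \<Rightarrow> 'b) \<Rightarrow> bool" where
  "digitally_continuous \<kappa> \<mu> X Y f \<longleftrightarrow>
     f \<in> X \<rightarrow> Y \<and>
     (\<forall>x0\<in>X. \<forall>x1\<in>X. \<kappa> x0 x1 \<longrightarrow> f x0 = f x1 \<or> \<mu> (f x0) (f x1))"

definition dnbhd :: "('a \<Rightarrow> 'a \<Rightarrow> bool) \<Rightarrow> 'a set \<Rightarrow> 'a \<Rightarrow> 'a set" where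
  "dnbhd \<kappa> X x = {y \<in> X. y = x \<or> \<kappa> y x}"

definition dInt :: "('a \<Rightarrow> 'a \<Rightarrow> bool) \<Rightarrow> 'a set \<Rightarrow> 'a set \<Rightarrow> 'a set" where
  "dInt \<kappa> X A = {x \<in> A. dnbhd \<kappa> X x \<subseteq> A}"

definition dCl :: "('a \<Rightarrow> 'a \<Rightarrow> bool) \<Rightarrow> 'a set \<Rightarrow> 'a set \<Rightarrow> 'a set" where
  "dCl \<kappa> X A = {x \<in> X. dnbhd \<kappa> X x \<inter> A \<noteq> {}}"


section \<open>Cubes\<close>

definition unit_cube :: "nat \<Rightarrow> int list set" where
  "unit_cube n = {t. length t = n \<and> set t \<subseteq> {0, 1}}"

text \<open>
  All degrees are integers, and there are no cubes of negative degree, so that every group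
  below is trivial in negative degrees. Cubes are extensional functions, so that equal cubes
  are equal as elements of the type, and a cube in a subset is literally a cube in the whole image.
\<close>

definition dcubes :: "('a \<Rightarrow> 'a \<Rightarrow> bool) \<Rightarrow> int \<Rightarrow> 'a set \<Rightarrow> (int list \<Rightarrow> 'a) set" where
  "dcubes \<kappa> n X =
     (if n < 0 then {}
      else {T \<in> extensional (unit_cube (nat n)).
              digitally_continuous (c_adj 1) \<kappa> (unit_cube (nat n)) X T})"

text \<open>List positions are counted from 0, so position \<open>i\<close> stands for the coordinate \<open>t\<^bsub>i+1\<^esub>\<close>.\<close>

definition degenerate_cube :: "int \<Rightarrow> (int list \<Rightarrow> 'a) \<Rightarrow> bool" where
  "degenerate_cube n T \<longleftrightarrow>
     (\<exists>i < nat n. \<forall>s \<in> unit_cube (nat n). \<forall>t \<in> unit_cube (nat n).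
        (\<forall>j < nat n. j \<noteq> i \<longrightarrow> s ! j = t ! j) \<longrightarrow> T s = T t)"

text \<open>\<open>cube_face 0 n i T\<close> is \<open>A\<^sub>i T\<close> and \<open>cube_face 1 n i T\<close> is \<open>B\<^sub>i T\<close>, for \<open>1 \<le> i \<le> n\<close>.\<close>

definition cube_face :: "int \<Rightarrow> nat \<Rightarrow> nat \<Rightarrow> (int list \<Rightarrow> 'a) \<Rightarrow> (int list \<Rightarrow> 'a)" where
  "cube_face e n i T =
     restrict (\<lambda>t. T (take (i - 1) t @ e # drop (i - 1) t)) (unit_cube (n - 1))"


section \<open>Chain complexes\<close>

definition dQ :: "('a \<Rightarrow> 'a \<Rightarrow> bool) \<Rightarrow> int \<Rightarrow> 'a set \<Rightarrow> ((int list \<Rightarrow> 'a) \<Rightarrow>\<^sub>0 int) monoid" where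
  "dQ \<kappa> n X = free_Abelian_group (dcubes \<kappa> n X)"

definition dD :: "('a \<Rightarrow> 'a \<Rightarrow> bool) \<Rightarrow> int \<Rightarrow> 'a set \<Rightarrow> ((int list \<Rightarrow> 'a) \<Rightarrow>\<^sub>0 int) set" where
  "dD \<kappa> n X =
     generate (dQ \<kappa> n X) (frag_of ` {T \<in> dcubes \<kappa> n X. degenerate_cube n T})"

definition dC :: "('a \<Rightarrow> 'a \<Rightarrow> bool) \<Rightarrow> int \<Rightarrow> 'a set \<Rightarrow> ((int list \<Rightarrow> 'a) \<Rightarrow>\<^sub>0 int) set monoid" where
  "dC \<kappa> n X = dQ \<kappa> n X Mod dD \<kappa> n X"

definition dQ_boundary ::
    "int \<Rightarrow> ((int list \<Rightarrow> 'a) \<Rightarrow>\<^sub>0 int) \<Rightarrow> ((int list \<Rightarrow> 'a) \<Rightarrow>\<^sub>0 int)" where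
  "dQ_boundary n =
     frag_extend (\<lambda>T. \<Sum>i = 1..nat n.
       frag_cmul ((- 1) ^ i)
         (frag_of (cube_face 0 (nat n) i T) - frag_of (cube_face 1 (nat n) i T)))"

definition dQ_map ::
    "int \<Rightarrow> ('a \<Rightarrow> 'b) \<Rightarrow> ((int list \<Rightarrow> 'a) \<Rightarrow>\<^sub>0 int) \<Rightarrow> ((int list \<Rightarrow> 'b) \<Rightarrow>\<^sub>0 int)" where
  "dQ_map n f = frag_extend (\<lambda>T. frag_of (restrict (f \<circ> T) (unit_cube (nat n))))"

text \<open>
  A homomorphism \<open>h : G \<rightarrow> H\<close> with \<open>h(N) \<subseteq> M\<close> induces \<open>G/N \<rightarrow> H/M\<close>; the image of a coset \<open>C\<close>
  is \<open>M \<cdot> h(C)\<close>, which is the coset of \<open>h x\<close> for any \<open>x \<in> C\<close>.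
\<close>

definition quot_map ::
    "('b, 'm) monoid_scheme \<Rightarrow> 'b set \<Rightarrow> ('a \<Rightarrow> 'b) \<Rightarrow> 'a set \<Rightarrow> 'b set" where
  "quot_map H M h C = M <#>\<^bsub>H\<^esub> (h ` C)"

lemma quot_map_r_coset:
  assumes "group G" "group H" "subgroup N G" "subgroup M H"
    and "h \<in> hom G H" "h ` N \<subseteq> M" "x \<in> carrier G"
  shows "quot_map H M h (N #>\<^bsub>G\<^esub> x) = M #>\<^bsub>H\<^esub> h x"
proof -
  interpret G: group G by fact
  interpret H: group H by fact
  interpret N: subgroup N G by fact
  interpret M: subgroup M H by fact
  have hm: "h (n \<otimes>\<^bsub>G\<^esub> x) = h n \<otimes>\<^bsub>H\<^esub> h x" if "n \<in> N" for n
    using assms(5,7) that by (simp add: hom_mult)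
  have hx: "h x \<in> carrier H"
    using assms(5,7) by (simp add: hom_in_carrier)
  show ?thesis
  proof (intro equalityI subsetI)
    fix y assume "y \<in> quot_map H M h (N #>\<^bsub>G\<^esub> x)"
    then obtain m n where mn: "m \<in> M" "n \<in> N" "y = m \<otimes>\<^bsub>H\<^esub> h (n \<otimes>\<^bsub>G\<^esub> x)"
      by (auto simp: quot_map_def set_mult_def r_coset_def)
    moreover have "h n \<in> M"
      using mn(2) assms(6) by auto
    ultimately have "y = (m \<otimes>\<^bsub>H\<^esub> h n) \<otimes>\<^bsub>H\<^esub> h x" "m \<otimes>\<^bsub>H\<^esub> h n \<in> M"
      using hm hx by (auto simp: H.m_assoc)
    then show "y \<in> M #>\<^bsub>H\<^esub> h x"
      by (auto simp: r_coset_def)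
  next
    fix y assume "y \<in> M #>\<^bsub>H\<^esub> h x"
    then obtain m where m: "m \<in> M" "y = m \<otimes>\<^bsub>H\<^esub> h x"
      by (auto simp: r_coset_def)
    moreover have "x \<in> N #>\<^bsub>G\<^esub> x"
      using assms(7) N.one_closed by (force simp: r_coset_def)
    ultimately show "y \<in> quot_map H M h (N #>\<^bsub>G\<^esub> x)"
      by (auto simp: quot_map_def set_mult_def)
  qed
qed

definition dC_boundary ::
    "('a \<Rightarrow> 'a \<Rightarrow> bool) \<Rightarrow> int \<Rightarrow> 'a set \<Rightarrow>
      ((int list \<Rightarrow> 'a) \<Rightarrow>\<^sub>0 int) set \<Rightarrow> ((int list \<Rightarrow> 'a) \<Rightarrow>\<^sub>0 int) set" where
  "dC_boundary \<kappa> n X = quot_map (dQ \<kappa> (n - 1) X) (dD \<kappa> (n - 1) X) (dQ_boundary n)"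

text \<open>For the maps induced by \<open>f : X \<rightarrow> Y\<close>, only the data of the target enter the formulas.\<close>

definition dC_map ::
    "('b \<Rightarrow> 'b \<Rightarrow> bool) \<Rightarrow> int \<Rightarrow> 'b set \<Rightarrow> ('a \<Rightarrow> 'b) \<Rightarrow>
      ((int list \<Rightarrow> 'a) \<Rightarrow>\<^sub>0 int) set \<Rightarrow> ((int list \<Rightarrow> 'b) \<Rightarrow>\<^sub>0 int) set" where
  "dC_map \<mu> n Y f = quot_map (dQ \<mu> n Y) (dD \<mu> n Y) (dQ_map n f)"


section \<open>Relative homology\<close>

text \<open>\<open>dC\<^sub>n(A)\<close> as a subgroup of \<open>dC\<^sub>n(X)\<close>: the image under the inclusion of \<open>A\<close> into \<open>X\<close>.\<close>

definition dC_sub ::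
    "('a \<Rightarrow> 'a \<Rightarrow> bool) \<Rightarrow> int \<Rightarrow> 'a set \<Rightarrow> 'a set \<Rightarrow> ((int list \<Rightarrow> 'a) \<Rightarrow>\<^sub>0 int) set set" where
  "dC_sub \<kappa> n X A = dC_map \<kappa> n X (\<lambda>x. x) ` carrier (dC \<kappa> n A)"

definition dC_rel ::
    "('a \<Rightarrow> 'a \<Rightarrow> bool) \<Rightarrow> int \<Rightarrow> 'a set \<Rightarrow> 'a set \<Rightarrow> ((int list \<Rightarrow> 'a) \<Rightarrow>\<^sub>0 int) set set monoid" where
  "dC_rel \<kappa> n X A = dC \<kappa> n X Mod dC_sub \<kappa> n X A"

definition dC_rel_boundary ::
    "('a \<Rightarrow> 'a \<Rightarrow> bool) \<Rightarrow> int \<Rightarrow> 'a set \<Rightarrow> 'a set \<Rightarrow>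
      ((int list \<Rightarrow> 'a) \<Rightarrow>\<^sub>0 int) set set \<Rightarrow> ((int list \<Rightarrow> 'a) \<Rightarrow>\<^sub>0 int) set set" where
  "dC_rel_boundary \<kappa> n X A =
     quot_map (dC \<kappa> (n - 1) X) (dC_sub \<kappa> (n - 1) X A) (dC_boundary \<kappa> n X)"

definition dC_rel_map ::
    "('b \<Rightarrow> 'b \<Rightarrow> bool) \<Rightarrow> int \<Rightarrow> 'b set \<Rightarrow> 'b set \<Rightarrow> ('a \<Rightarrow> 'b) \<Rightarrow>
      ((int list \<Rightarrow> 'a) \<Rightarrow>\<^sub>0 int) set set \<Rightarrow> ((int list \<Rightarrow> 'b) \<Rightarrow>\<^sub>0 int) set set" where
  "dC_rel_map \<mu> n Y B f = quot_map (dC \<mu> n Y) (dC_sub \<mu> n Y B) (dC_map \<mu> n Y f)"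

definition rel_cycles ::
    "('a \<Rightarrow> 'a \<Rightarrow> bool) \<Rightarrow> int \<Rightarrow> 'a set \<Rightarrow> 'a set \<Rightarrow> ((int list \<Rightarrow> 'a) \<Rightarrow>\<^sub>0 int) set set monoid" where
  "rel_cycles \<kappa> n X A =
     (dC_rel \<kappa> n X A)
       \<lparr>carrier := kernel (dC_rel \<kappa> n X A) (dC_rel \<kappa> (n - 1) X A) (dC_rel_boundary \<kappa> n X A)\<rparr>"

definition rel_boundaries ::
    "('a \<Rightarrow> 'a \<Rightarrow> bool) \<Rightarrow> int \<Rightarrow> 'a set \<Rightarrow> 'a set \<Rightarrow> ((int list \<Rightarrow> 'a) \<Rightarrow>\<^sub>0 int) set set set" where
  "rel_boundaries \<kappa> n X A =
     dC_rel_boundary \<kappa> (n + 1) X A ` carrier (dC_rel \<kappa> (n + 1) X A)"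

definition dH ::
    "('a \<Rightarrow> 'a \<Rightarrow> bool) \<Rightarrow> int \<Rightarrow> 'a set \<Rightarrow> 'a set \<Rightarrow> ((int list \<Rightarrow> 'a) \<Rightarrow>\<^sub>0 int) set set set monoid" where
  "dH \<kappa> n X A = rel_cycles \<kappa> n X A Mod rel_boundaries \<kappa> n X A"

definition dH_map ::
    "('b \<Rightarrow> 'b \<Rightarrow> bool) \<Rightarrow> int \<Rightarrow> 'b set \<Rightarrow> 'b set \<Rightarrow> ('a \<Rightarrow> 'b) \<Rightarrow>
      ((int list \<Rightarrow> 'a) \<Rightarrow>\<^sub>0 int) set set set \<Rightarrow> ((int list \<Rightarrow> 'b) \<Rightarrow>\<^sub>0 int) set set set" where
  "dH_map \<mu> n Y B f =
     quot_map (rel_cycles \<mu> n Y B) (rel_boundaries \<mu> n Y B) (dC_rel_map \<mu> n Y B f)"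

end

theory Submission
  imports Defs
begin

text \<open>
  A cube of dimension at most 2 has diameter at most 2, so any two of its vertices are equal or
  adjacent to a common vertex \<open>v\<close>. As the image of \<open>v\<close> lies in the interior of \<open>A\<close> or of \<open>B\<close>, both vertices are
  mapped into \<open>A\<close> or both into \<open>B\<close>; hence every such cube is a cube in \<open>A\<close> or in \<open>B\<close>. No subdivision is
  therefore needed: the inclusion is already an isomorphism on relative chains in degrees at most 2,
  and this gives the isomorphisms on homology in degrees below 2. Part (1) is the case \<open>B = X - W\<close>.
\<close>

section \<open>Homomorphisms of quotient groups\<close>

text \<open>The data under which \<open>quot_map\<close> sends cosets to cosets. Commutativity makes
  every subgroup normal, so both quotients are groups. The pair \<open>N\<close>, \<open>M\<close>
  will be degenerate chains, then chains of a subset, then boundaries.\<close>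

locale quot_hom =
  G: comm_group G + H: comm_group H + N: subgroup N G + M: subgroup M H
  for G (structure) and H (structure) and N M +
  fixes h
  assumes h_hom: "h \<in> hom G H" and h_sub: "h ` N \<subseteq> M"
begin

lemma quot_map_coset:
  "x \<in> carrier G \<Longrightarrow> quot_map H M h (N #>\<^bsub>G\<^esub> x) = M #>\<^bsub>H\<^esub> h x"
  by (intro quot_map_r_coset h_hom h_sub G.is_group H.is_group N.subgroup_axioms M.subgroup_axioms)

lemma h_closed: "x \<in> carrier G \<Longrightarrow> h x \<in> carrier H"
  using h_hom by (rule hom_in_carrier)

lemma quot_map_hom: "quot_map H M h \<in> hom (G Mod N) (H Mod M)"
proof -
  interpret N: normal N G by (rule G.subgroup_imp_normal[OF N.subgroup_axioms])
  interpret M: normal M H by (rule H.subgroup_imp_normal[OF M.subgroup_axioms])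
  show ?thesis
    by (rule homI)
      (auto simp: carrier_FactGroup quot_map_coset h_closed N.rcos_sum M.rcos_sum hom_mult[OF h_hom])
qed

text \<open>Together with \<open>h_sub\<close> the hypothesis makes \<open>N\<close> the full
  preimage of \<open>M\<close>, so two cosets with the same image differ by an element of
  \<open>N\<close>.\<close>

lemma quot_map_inj_on:
  assumes "\<And>x. x \<in> carrier G \<Longrightarrow> h x \<in> M \<Longrightarrow> x \<in> N"
  shows "inj_on (quot_map H M h) (carrier (G Mod N))"
proof -
  interpret h: group_hom G H h
    using h_hom by unfold_locales
  show ?thesis
  proof (rule inj_onI)
    fix z w assume "z \<in> carrier (G Mod N)" "w \<in> carrier (G Mod N)"
      and eq: "quot_map H M h z = quot_map H M h w"
    then obtain x y where xy: "x \<in> carrier G" "y \<in> carrier G" "z = N #>\<^bsub>G\<^esub> x" "w = N #>\<^bsub>G\<^esub> y"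
      by (auto simp: carrier_FactGroup)
    then have "h x \<in> M #>\<^bsub>H\<^esub> h y"
      using eq H.rcos_self[OF h_closed[OF xy(1)] M.subgroup_axioms] by (simp add: quot_map_coset)
    then have "h (x \<otimes>\<^bsub>G\<^esub> inv\<^bsub>G\<^esub> y) \<in> M"
      using M.rcos_module_imp[OF H.is_group] xy by simp
    then have "x \<in> N #>\<^bsub>G\<^esub> y"
      using assms xy by (intro N.rcos_module_rev G.is_group) auto
    then show "z = w"
      using xy G.repr_independence N.subgroup_axioms by auto
  qed
qed

lemma quot_map_surj:
  assumes "\<And>y. y \<in> carrier H \<Longrightarrow> \<exists>x\<in>carrier G. y \<in> M #>\<^bsub>H\<^esub> h x"
  shows "quot_map H M h ` carrier (G Mod N) = carrier (H Mod M)"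
proof
  show "quot_map H M h ` carrier (G Mod N) \<subseteq> carrier (H Mod M)"
    using quot_map_hom by (auto simp: hom_def)
  show "carrier (H Mod M) \<subseteq> quot_map H M h ` carrier (G Mod N)"
  proof
    fix w assume "w \<in> carrier (H Mod M)"
    then obtain y where y: "y \<in> carrier H" "w = M #>\<^bsub>H\<^esub> y"
      by (auto simp: carrier_FactGroup)
    then obtain x where x: "x \<in> carrier G" "y \<in> M #>\<^bsub>H\<^esub> h x"
      using assms by blast
    then have "w = quot_map H M h (N #>\<^bsub>G\<^esub> x)"
      using y H.repr_independence[OF x(2) h_closed M.subgroup_axioms] by (simp add: quot_map_coset)
    then show "w \<in> quot_map H M h ` carrier (G Mod N)"
      using x by (auto simp: carrier_FactGroup)
  qed
qed

lemma quot_map_iso: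
  assumes "\<And>x. x \<in> carrier G \<Longrightarrow> h x \<in> M \<Longrightarrow> x \<in> N"
    and "\<And>y. y \<in> carrier H \<Longrightarrow> \<exists>x\<in>carrier G. y \<in> M #>\<^bsub>H\<^esub> h x"
  shows "quot_map H M h \<in> iso (G Mod N) (H Mod M)"
  using quot_map_hom quot_map_inj_on[OF assms(1)] quot_map_surj[OF assms(2)]
  by (auto simp: iso_def bij_betw_def)

end

text \<open>Both composites send the coset of \<open>x\<close> to the coset of the common value
  \<open>g (f x)\<close>. This carries commutation with the boundary from free chains to
  \<open>dC\<close>, and then from \<open>dC\<close> to \<open>dC_rel\<close>.\<close>

lemma quot_map_square:
  assumes "quot_hom G H N M f" "quot_hom H K M L g" "quot_hom G H' N M' f'" "quot_hom H' K M' L g'"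
    and "\<And>x. x \<in> carrier G \<Longrightarrow> g (f x) = g' (f' x)" "z \<in> carrier (G Mod N)"
  shows "quot_map K L g (quot_map H M f z) = quot_map K L g' (quot_map H' M' f' z)"
  using assms(5,6)
  by (auto simp: carrier_FactGroup quot_hom.quot_map_coset[OF assms(1)]
      quot_hom.quot_map_coset[OF assms(2)] quot_hom.quot_map_coset[OF assms(3)]
      quot_hom.quot_map_coset[OF assms(4)] quot_hom.h_closed[OF assms(1)]
      quot_hom.h_closed[OF assms(3)])

text \<open>Meant for chain groups \<open>G\<close>, \<open>H\<close> with cycles \<open>K\<close>,
  \<open>L\<close> and boundaries \<open>M\<close>, \<open>N\<close>. The quotient of the cycles is
  treated as a part of the quotient of all chains, where injectivity comes from that of
  \<open>f\<close>.\<close>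

lemma quot_map_iso_restrict:
  assumes "comm_group G" "comm_group H" "f \<in> iso G H" "subgroup M G"
    and "K \<subseteq> carrier G" "f ` K = L" "f ` M = N"
  shows "quot_map (H\<lparr>carrier := L\<rparr>) N f \<in> iso ((G\<lparr>carrier := K\<rparr>) Mod M) ((H\<lparr>carrier := L\<rparr>) Mod N)"
proof -
  interpret group_hom G H f
    using assms by (auto simp: group_hom_def group_hom_axioms_def iso_def comm_group_def)
  have inj: "inj_on f (carrier G)"
    using assms(3) by (auto simp: iso_def bij_betw_def)
  have N: "subgroup N H"
    using subgroup_img_is_subgroup[OF assms(4)] assms(7) by simp
  interpret Q: quot_hom G H M N f
    using assms N by (intro quot_hom.intro) (auto simp: quot_hom_axioms_def)
  \<comment> \<open>Coset and product formulas use only the multiplication, so shrinking the carrier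
    to \<open>K\<close> merely selects cosets of \<open>G Mod M\<close>.\<close>
  have carrK: "carrier ((G\<lparr>carrier := K\<rparr>) Mod M) = (\<lambda>x. M #>\<^bsub>G\<^esub> x) ` K"
    and carrL: "carrier ((H\<lparr>carrier := L\<rparr>) Mod N) = (\<lambda>x. N #>\<^bsub>H\<^esub> x) ` L"
    by (auto simp: carrier_FactGroup r_coset_def)
  have multK: "x \<otimes>\<^bsub>(G\<lparr>carrier := K\<rparr>) Mod M\<^esub> y = x \<otimes>\<^bsub>G Mod M\<^esub> y"
    and multL: "u \<otimes>\<^bsub>(H\<lparr>carrier := L\<rparr>) Mod N\<^esub> v = u \<otimes>\<^bsub>H Mod N\<^esub> v" for x y u v
    by (simp_all add: FactGroup_def set_mult_def)
  have quot: "quot_map (H\<lparr>carrier := L\<rparr>) N f = quot_map H N f"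
    by (auto simp: quot_map_def set_mult_def fun_eq_iff)
  have KM: "(\<lambda>x. M #>\<^bsub>G\<^esub> x) ` K \<subseteq> carrier (G Mod M)"
    using assms(5) by (auto simp: carrier_FactGroup)
  have img: "quot_map H N f ` (\<lambda>x. M #>\<^bsub>G\<^esub> x) ` K = (\<lambda>x. N #>\<^bsub>H\<^esub> x) ` L"
    using assms(5) by (simp add: image_image Q.quot_map_coset subset_iff flip: assms(6) cong: image_cong_simp)
  have "x \<in> M" if "x \<in> carrier G" "f x \<in> N" for x
    using that inj assms(7) subgroup.subset[OF assms(4)] by (auto dest: inj_onD)
  then have "inj_on (quot_map H N f) ((\<lambda>x. M #>\<^bsub>G\<^esub> x) ` K)"
    using Q.quot_map_inj_on KM inj_on_subset by blast
  then show ?thesis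
    using img KM Group.hom_mult[OF Q.quot_map_hom]
    by (intro isoI homI) (auto simp: carrK carrL multK multL quot bij_betw_def subset_iff)
qed

section \<open>Faces of digital cubes\<close>

lemma c_adj_sym:
  assumes "c_adj l p q"
  shows "c_adj l q p"
proof -
  have "{i. i < length q \<and> q ! i \<noteq> p ! i} = {i. i < length p \<and> p ! i \<noteq> q ! i}"
    using assms by (auto simp: c_adj_def)
  then show ?thesis
    using assms by (auto simp: c_adj_def abs_minus_commute)
qed

lemma unit_cube_insert:
  assumes "t \<in> unit_cube (n - 1)" "e \<in> {0, 1}" "1 \<le> n"
  shows "take k t @ e # drop k t \<in> unit_cube n"
  using assms by (auto simp: unit_cube_def dest!: in_set_takeD in_set_dropD)

lemma nth_insert_at:
  assumes "k \<le> length p" "j \<le> length p"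
  shows "(take k p @ e # drop k p) ! j = (if j < k then p ! j else if j = k then e else p ! (j - 1))"
  using assms by (auto simp: nth_append nth_Cons' intro!: arg_cong[of _ _ "(!) p"])

text \<open>Inserting the same \<open>e\<close> into both lists creates no new difference, and an
  old one at \<open>j\<close> stays at \<open>j\<close> or moves to \<open>Suc j\<close>. Hence the
  number of differing positions does not grow.\<close>

lemma c_adj_insert:
  assumes "c_adj l p q" "k \<le> length p"
  shows "c_adj l (take k p @ e # drop k p) (take k q @ e # drop k q)"
proof -
  let ?ins = "\<lambda>p. take k p @ e # drop k p"
  let ?D = "{j. j < length p \<and> p ! j \<noteq> q ! j}"
  have len: "length q = length p" and kq: "k \<le> length q"
    using assms by (auto simp: c_adj_def)
  have "{j. j < length (?ins p) \<and> ?ins p ! j \<noteq> ?ins q ! j} \<subseteq> (\<lambda>j. if j < k then j else Suc j) ` ?D"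
  proof
    fix j assume j: "j \<in> {j. j < length (?ins p) \<and> ?ins p ! j \<noteq> ?ins q ! j}"
    show "j \<in> (\<lambda>j. if j < k then j else Suc j) ` ?D"
    proof (cases "j < k")
      case True
      then show ?thesis using j assms(2) kq len by (intro image_eqI[of _ _ j]) (auto simp: nth_insert_at)
    next
      case False
      then show ?thesis using j assms(2) kq len
        by (intro image_eqI[of _ _ "j - 1"]) (auto simp: nth_insert_at split: if_splits)
    qed
  qed
  then have "card {j. j < length (?ins p) \<and> ?ins p ! j \<noteq> ?ins q ! j} \<le> card ?D"
    by (rule surj_card_le[rotated]) simp
  moreover have "?ins p \<noteq> ?ins q"
    using assms len by (auto simp: c_adj_def) (metis append_take_drop_id)
  ultimately show ?thesis
    using assms len kq by (auto simp: c_adj_def nth_insert_at)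
qed

text \<open>A face is \<open>T\<close> precomposed with the insertion of \<open>e\<close> at list
  position \<open>i - 1\<close>, and this insertion preserves adjacency.\<close>

lemma cube_face_in_dcubes:
  assumes T: "T \<in> dcubes \<kappa> (int n) X" and i: "i \<in> {1..n}" and e: "e \<in> {0, 1}"
  shows "cube_face e n i T \<in> dcubes \<kappa> (int n - 1) X"
proof -
  have n: "nat (int n - 1) = n - 1" "1 \<le> n" using i by auto
  have "digitally_continuous (c_adj 1) \<kappa> (unit_cube (n - 1)) X (cube_face e n i T)"
    unfolding digitally_continuous_def
  proof (intro conjI ballI impI funcsetI)
    fix t assume "t \<in> unit_cube (n - 1)"
    then show "cube_face e n i T t \<in> X"
      using T n funcset_mem[of T "unit_cube n" X, OF _ unit_cube_insert[of t n e "i - 1", OF _ e]]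
      by (auto simp: cube_face_def dcubes_def digitally_continuous_def)
  next
    fix s t assume st: "s \<in> unit_cube (n - 1)" "t \<in> unit_cube (n - 1)" "c_adj 1 s t"
    have "c_adj 1 (take (i - 1) s @ e # drop (i - 1) s) (take (i - 1) t @ e # drop (i - 1) t)"
      using st i by (intro c_adj_insert) (auto simp: unit_cube_def)
    then show "cube_face e n i T s = cube_face e n i T t \<or> \<kappa> (cube_face e n i T s) (cube_face e n i T t)"
      using st T e n unit_cube_insert[OF st(1) e] unit_cube_insert[OF st(2) e]
      by (auto simp: cube_face_def dcubes_def digitally_continuous_def)
  qed
  then show ?thesis
    using n by (auto simp: dcubes_def cube_face_def)
qed

definition degenerate_cubes :: "('a \<Rightarrow> 'a \<Rightarrow> bool) \<Rightarrow> int \<Rightarrow> 'a set \<Rightarrow> (int list \<Rightarrow> 'a) set" where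
  "degenerate_cubes \<kappa> n X = {T \<in> dcubes \<kappa> n X. degenerate_cube n T}"

text \<open>If the ignored coordinate is the one frozen by the face, the two faces in that direction
  agree and cancel in the boundary. Otherwise it survives as a coordinate that the face still
  ignores. So the boundary preserves degenerate chains.\<close>

lemma degenerate_cube_faces:
  assumes T: "T \<in> degenerate_cubes \<kappa> (int n) X" and i: "i \<in> {1..n}"
  shows "cube_face 0 n i T = cube_face 1 n i T \<or>
    (\<forall>e \<in> {0, 1}. cube_face e n i T \<in> degenerate_cubes \<kappa> (int n - 1) X)"
proof -
  obtain k where k: "k < n"
    and indep: "\<And>s t. s \<in> unit_cube n \<Longrightarrow> t \<in> unit_cube n \<Longrightarrow> \<forall>j<n. j \<noteq> k \<longrightarrow> s ! j = t ! j \<Longrightarrow> T s = T t"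
    using T unfolding degenerate_cubes_def degenerate_cube_def by auto
  have n: "nat (int n - 1) = n - 1" "1 \<le> n" using i by auto
  show ?thesis
  proof (cases "k = i - 1")
    case True
    have "T (take (i - 1) t @ 0 # drop (i - 1) t) = T (take (i - 1) t @ 1 # drop (i - 1) t)"
      if t: "t \<in> unit_cube (n - 1)" for t
    proof -
      have "length t = n - 1" using t by (simp add: unit_cube_def)
      then show ?thesis using t i True
        by (intro indep unit_cube_insert) (auto simp: nth_insert_at)
    qed
    then have "cube_face 0 n i T = cube_face 1 n i T"
      by (simp add: cube_face_def cong: restrict_cong)
    then show ?thesis ..
  next
    case False
    \<comment> \<open>Inserting at position \<open>i - 1\<close> pushes later entries up by one;
      \<open>k'\<close> is the position in the face that becomes \<open>k\<close> in the
      cube.\<close>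
    define k' where "k' = (if k < i - 1 then k else k - 1)"
    have "degenerate_cube (int n - 1) (cube_face e n i T)" if e: "e \<in> {0, 1}" for e
      unfolding degenerate_cube_def n
    proof (intro exI[of _ k'] conjI ballI impI)
      show "k' < n - 1" using False k i by (auto simp: k'_def)
      fix s t assume st: "s \<in> unit_cube (n - 1)" "t \<in> unit_cube (n - 1)"
        and eq: "\<forall>j<n - 1. j \<noteq> k' \<longrightarrow> s ! j = t ! j"
      have len: "length s = n - 1" "length t = n - 1" using st by (auto simp: unit_cube_def)
      have "T (take (i - 1) s @ e # drop (i - 1) s) = T (take (i - 1) t @ e # drop (i - 1) t)"
        using st e n i False len
        by (intro indep unit_cube_insert)
          (auto simp: nth_insert_at k'_def split: if_splits intro!: eq[rule_format])
      then show "cube_face e n i T s = cube_face e n i T t"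
        using st by (simp add: cube_face_def)
    qed
    then show ?thesis
      using T i cube_face_in_dcubes[of T \<kappa> n X i] by (auto simp: degenerate_cubes_def)
  qed
qed

section \<open>Cubes in subsets and covers by interiors\<close>

lemma dcubes_mono: "A \<subseteq> X \<Longrightarrow> dcubes \<kappa> n A \<subseteq> dcubes \<kappa> n X"
  by (auto simp: dcubes_def digitally_continuous_def)

lemma dcubes_Int: "dcubes \<kappa> n A \<inter> dcubes \<kappa> n B = dcubes \<kappa> n (A \<inter> B)"
  by (auto simp: dcubes_def digitally_continuous_def)

lemma dcubes_cover:
  assumes sym: "\<And>x y. \<kappa> x y \<Longrightarrow> \<kappa> y x"
    and X: "X = dInt \<kappa> X A \<union> dInt \<kappa> X B" and "n \<le> 2" and T: "T \<in> dcubes \<kappa> n X"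
  shows "T \<in> dcubes \<kappa> n A \<union> dcubes \<kappa> n B"
proof -
  let ?I = "unit_cube (nat n)"
  have n: "n \<ge> 0" using T by (auto simp: dcubes_def split: if_splits)
  have near: "T s \<in> dnbhd \<kappa> X (T u)" if "s \<in> ?I" "u \<in> ?I" "s = u \<or> c_adj 1 s u" for s u
    using that T n by (auto simp: dcubes_def digitally_continuous_def dnbhd_def)
  \<comment> \<open>The dimension bound enters here: opposite corners of a 3-cube have no such
    \<open>u\<close>.\<close>
  have mid: "\<exists>u \<in> ?I. (s = u \<or> c_adj 1 s u) \<and> (t = u \<or> c_adj 1 t u)" if st: "s \<in> ?I" "t \<in> ?I" for s t
  proof -
    have "nat n = 0 \<or> nat n = 1 \<or> nat n = 2" using n \<open>n \<le> 2\<close> by linarith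
    then show ?thesis
    proof (elim disjE)
      assume "nat n = 0"
      then show ?thesis using st by (auto simp: unit_cube_def)
    next
      assume n1: "nat n = 1"
      obtain a where s: "s = [a]" "a \<in> {0, 1}"
        using st n1 by (auto simp: unit_cube_def length_Suc_conv)
      obtain b where t: "t = [b]" "b \<in> {0, 1}"
        using st n1 by (auto simp: unit_cube_def length_Suc_conv)
      have "c_adj 1 [b] [a]" if "a \<noteq> b"
      proof -
        have "{i. i < length [b] \<and> [b] ! i \<noteq> [a] ! i} \<subseteq> {0}" by auto
        then have "card {i. i < length [b] \<and> [b] ! i \<noteq> [a] ! i} \<le> 1"
          using card_mono[of "{0 :: nat}"] by auto
        then show ?thesis using that s t by (auto simp: c_adj_def)
      qed
      then show ?thesis using s t st by (intro bexI[of _ s]) auto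
    next
      assume n2: "nat n = 2"
      obtain a a' where s: "s = [a, a']" "a \<in> {0, 1}" "a' \<in> {0, 1}"
        using st n2 by (auto simp: unit_cube_def length_Suc_conv numeral_2_eq_2)
      obtain b b' where t: "t = [b, b']" "b \<in> {0, 1}" "b' \<in> {0, 1}"
        using st n2 by (auto simp: unit_cube_def length_Suc_conv numeral_2_eq_2)
      have "c_adj 1 [a, a'] [a, b']" if "a' \<noteq> b'"
      proof -
        have "{i. i < length [a, a'] \<and> [a, a'] ! i \<noteq> [a, b'] ! i} \<subseteq> {1}"
          by (auto simp: less_Suc_eq)
        then have "card {i. i < length [a, a'] \<and> [a, a'] ! i \<noteq> [a, b'] ! i} \<le> 1"
          using card_mono[of "{1 :: nat}"] by auto
        then show ?thesis using that s t by (auto simp: c_adj_def less_Suc_eq)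
      qed
      moreover have "c_adj 1 [b, b'] [a, b']" if "a \<noteq> b"
      proof -
        have "{i. i < length [b, b'] \<and> [b, b'] ! i \<noteq> [a, b'] ! i} \<subseteq> {0}"
          by (auto simp: less_Suc_eq)
        then have "card {i. i < length [b, b'] \<and> [b, b'] ! i \<noteq> [a, b'] ! i} \<le> 1"
          using card_mono[of "{0 :: nat}"] by auto
        then show ?thesis using that s t by (auto simp: c_adj_def less_Suc_eq)
      qed
      \<comment> \<open>The corner with first coordinate from \<open>s\<close> and second from
        \<open>t\<close> differs from each of them in at most one place.\<close>
      moreover have "[a, b'] \<in> ?I" using s t n2 by (auto simp: unit_cube_def)
      ultimately show ?thesis using s t by (intro bexI[of _ "[a, b']"]) auto
    qed
  qed
  have "(\<forall>s\<in>?I. T s \<in> A) \<or> (\<forall>t\<in>?I. T t \<in> B)"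
  proof (rule ccontr)
    assume "\<not> ?thesis"
    then obtain s t where st: "s \<in> ?I" "T s \<notin> A" "t \<in> ?I" "T t \<notin> B" by auto
    then obtain u where u: "u \<in> ?I" "s = u \<or> c_adj 1 s u" "t = u \<or> c_adj 1 t u"
      using mid by blast
    have "T u \<in> X" using u T n by (auto simp: dcubes_def digitally_continuous_def)
    \<comment> \<open>Whichever interior contains \<open>T u\<close>, its set contains the whole
      neighbourhood of \<open>T u\<close>, and \<open>T s\<close> and \<open>T t\<close> both lie in
      that neighbourhood.\<close>
    then have "dnbhd \<kappa> X (T u) \<subseteq> A \<or> dnbhd \<kappa> X (T u) \<subseteq> B"
      using X by (auto simp: dInt_def)
    then show False
      using near[of s u] near[of t u] st u by blast
  qed
  then show ?thesis
    using T n by (auto simp: dcubes_def digitally_continuous_def)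
qed

section \<open>Chains\<close>

lemma carrier_dQ: "carrier (dQ \<kappa> n X) = {c. Poly_Mapping.keys c \<subseteq> dcubes \<kappa> n X}"
  by (auto simp: dQ_def)

lemma mult_dQ [simp]: "x \<otimes>\<^bsub>dQ \<kappa> n X\<^esub> y = x + y"
  by (simp add: dQ_def)

lemma comm_group_dQ: "comm_group (dQ \<kappa> n X)"
  by (simp add: dQ_def abelian_free_Abelian_group)

text \<open>Chains supported on \<open>S\<close> form a subgroup containing the generators, and
  induction over differences reaches each of them. This turns membership in \<open>dD\<close> into a
  condition on keys.\<close>

lemma generate_free_Abelian_group:
  assumes "S \<subseteq> U"
  shows "generate (free_Abelian_group U) (frag_of ` S) = {c. Poly_Mapping.keys c \<subseteq> S}"
proof -
  interpret group "free_Abelian_group U" by simp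
  have "subgroup {c. Poly_Mapping.keys c \<subseteq> S} (free_Abelian_group U)"
    using assms by (intro subgroupI) (auto dest: subsetD[OF keys_add])
  then have "generate (free_Abelian_group U) (frag_of ` S) \<subseteq> {c. Poly_Mapping.keys c \<subseteq> S}"
    by (intro generate_subgroup_incl) auto
  moreover have "c \<in> generate (free_Abelian_group U) (frag_of ` S)" if "Poly_Mapping.keys c \<subseteq> S" for c
    using that
  proof (induction c rule: frag_induction)
    case zero
    show ?case using generate.one[of "free_Abelian_group U"] by simp
  next
    case (one x)
    then show ?case by (auto intro: generate.incl)
  next
    case (diff a b)
    have "frag_of ` S \<subseteq> carrier (free_Abelian_group U)" using assms by auto
    then have sub: "subgroup (generate (free_Abelian_group U) (frag_of ` S)) (free_Abelian_group U)"
      by (rule generate_is_subgroup)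
    \<comment> \<open>Inversion in the free group is identified with negation only for elements of
      its carrier.\<close>
    have "Poly_Mapping.keys b \<subseteq> U" using subgroup.mem_carrier[OF sub diff(2)] by simp
    then show ?case
      using subgroup.m_closed[OF sub diff(1) subgroup.m_inv_closed[OF sub diff(2)]] by simp
  qed
  ultimately show ?thesis by auto
qed

lemma dD_eq: "dD \<kappa> n X = {c. Poly_Mapping.keys c \<subseteq> degenerate_cubes \<kappa> n X}"
  unfolding dD_def dQ_def degenerate_cubes_def by (rule generate_free_Abelian_group) auto

lemma subgroup_dD: "subgroup (dD \<kappa> n X) (dQ \<kappa> n X)"
proof -
  interpret comm_group "dQ \<kappa> n X" by (rule comm_group_dQ)
  show ?thesis
    unfolding dD_def by (rule generate_is_subgroup) (auto simp: carrier_dQ)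
qed

lemma comm_group_dC: "comm_group (dC \<kappa> n X)"
  unfolding dC_def by (intro comm_group.abelian_FactGroup comm_group_dQ subgroup_dD)

text \<open>Chain groups and their degenerate subgroups are both given by supports, and the support
  of \<open>frag_extend f c\<close> lies in the union of those of \<open>f T\<close> over the cubes
  of \<open>c\<close>. So single cubes are all there is to check, for the boundary as for
  inclusions.\<close>

lemma quot_hom_dQ_frag_extend:
  assumes "\<And>T. T \<in> dcubes \<kappa> n X \<Longrightarrow> Poly_Mapping.keys (f T) \<subseteq> dcubes \<mu> m Y"
    and "\<And>T. T \<in> degenerate_cubes \<kappa> n X \<Longrightarrow> Poly_Mapping.keys (f T) \<subseteq> degenerate_cubes \<mu> m Y"
  shows "quot_hom (dQ \<kappa> n X) (dQ \<mu> m Y) (dD \<kappa> n X) (dD \<mu> m Y) (frag_extend f)"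
proof (intro quot_hom.intro quot_hom_axioms.intro comm_group_dQ subgroup_dD homI)
  show "frag_extend f c \<in> carrier (dQ \<mu> m Y)" if "c \<in> carrier (dQ \<kappa> n X)" for c
    using that assms(1) keys_frag_extend[of f c] by (fastforce simp: carrier_dQ)
  show "frag_extend f ` dD \<kappa> n X \<subseteq> dD \<mu> m Y"
    using assms(2) keys_frag_extend[of f] by (fastforce simp: dD_eq)
qed (simp add: frag_extend_add)

text \<open>Terms with \<open>g i = h i\<close> cancel. This matters for a degenerate cube, whose
  two equal faces need not be degenerate themselves.\<close>

lemma keys_boundary_sum:
  "Poly_Mapping.keys (\<Sum>i = 1..n. frag_cmul ((- 1) ^ i) (frag_of (g i) - frag_of (h i)))
    \<subseteq> (\<Union>i\<in>{i. i \<in> {1..n} \<and> g i \<noteq> h i}. {g i, h i})"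
proof -
  have "Poly_Mapping.keys (frag_cmul ((- 1) ^ i) (frag_of (g i) - frag_of (h i)))
      \<subseteq> (if g i = h i then {} else {g i, h i})" for i
    using keys_cmul[of "(- 1) ^ i" "frag_of (g i) - frag_of (h i)"] keys_diff[of "frag_of (g i)" "frag_of (h i)"]
    by (auto split: if_splits)
  then show ?thesis
    by (intro order_trans[OF keys_sum]) (fastforce split: if_splits)
qed

lemma quot_hom_dQ_boundary:
  "quot_hom (dQ \<kappa> n X) (dQ \<kappa> (n - 1) X) (dD \<kappa> n X) (dD \<kappa> (n - 1) X) (dQ_boundary n)"
  unfolding dQ_boundary_def
proof (rule quot_hom_dQ_frag_extend)
  fix T
  assume "T \<in> dcubes \<kappa> n X"
  \<comment> \<open>Cubes exist only in nonnegative degree, so \<open>nat\<close> loses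
    nothing.\<close>
  moreover from this have "int (nat n) = n" by (auto simp: dcubes_def split: if_splits)
  ultimately show "Poly_Mapping.keys (\<Sum>i = 1..nat n. frag_cmul ((- 1) ^ i)
      (frag_of (cube_face 0 (nat n) i T) - frag_of (cube_face 1 (nat n) i T))) \<subseteq> dcubes \<kappa> (n - 1) X"
    using cube_face_in_dcubes[of T \<kappa> "nat n" X]
    by (intro order_trans[OF keys_boundary_sum]) auto
next
  fix T
  assume T: "T \<in> degenerate_cubes \<kappa> n X"
  then have "int (nat n) = n" by (auto simp: degenerate_cubes_def dcubes_def split: if_splits)
  then show "Poly_Mapping.keys (\<Sum>i = 1..nat n. frag_cmul ((- 1) ^ i)
      (frag_of (cube_face 0 (nat n) i T) - frag_of (cube_face 1 (nat n) i T)))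
      \<subseteq> degenerate_cubes \<kappa> (n - 1) X"
    using degenerate_cube_faces[of T \<kappa> "nat n" X] T
    by (intro order_trans[OF keys_boundary_sum]) fastforce
qed

section \<open>Inclusions on free chains\<close>

lemma dcube_restrict:
  assumes "T \<in> dcubes \<kappa> n A"
  shows "restrict ((\<lambda>x. x) \<circ> T) (unit_cube (nat n)) = T"
  using assms by (auto simp: dcubes_def comp_def extensional_restrict split: if_splits)

text \<open>Cubes are extensional, so restriction to the unit cube leaves them alone. The inclusion
  is then the identity on chains, and only the surrounding group changes.\<close>

lemma dQ_map_id:
  assumes "c \<in> carrier (dQ \<kappa> n A)"
  shows "dQ_map n (\<lambda>x. x) c = c"
proof -
  have "dQ_map n (\<lambda>x. x) c = frag_extend frag_of c"
    using assms dcube_restrict[of _ \<kappa> n A] unfolding dQ_map_def by (intro frag_extend_eq) (auto simp: carrier_dQ)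
  then show ?thesis by (simp flip: frag_expansion)
qed

lemma quot_hom_dQ_map:
  assumes "A \<subseteq> X"
  shows "quot_hom (dQ \<kappa> n A) (dQ \<kappa> n X) (dD \<kappa> n A) (dD \<kappa> n X) (dQ_map n (\<lambda>x. x))"
  unfolding dQ_map_def
  using dcube_restrict[of _ \<kappa> n A] dcubes_mono[OF assms, of \<kappa> n]
  by (intro quot_hom_dQ_frag_extend) (auto simp: degenerate_cubes_def)

section \<open>Relative chains\<close>

lemma dC_map_hom: "A \<subseteq> X \<Longrightarrow> dC_map \<kappa> n X (\<lambda>x. x) \<in> hom (dC \<kappa> n A) (dC \<kappa> n X)"
  unfolding dC_map_def dC_def by (intro quot_hom.quot_map_hom quot_hom_dQ_map)

lemma dC_boundary_hom: "dC_boundary \<kappa> n X \<in> hom (dC \<kappa> n X) (dC \<kappa> (n - 1) X)"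
  unfolding dC_boundary_def dC_def by (intro quot_hom.quot_map_hom quot_hom_dQ_boundary)

lemma dC_map_coset:
  assumes "A \<subseteq> X" "c \<in> carrier (dQ \<kappa> n A)"
  shows "dC_map \<kappa> n X (\<lambda>x. x) (dD \<kappa> n A #>\<^bsub>dQ \<kappa> n A\<^esub> c) = dD \<kappa> n X #>\<^bsub>dQ \<kappa> n X\<^esub> c"
  unfolding dC_map_def using quot_hom.quot_map_coset[OF quot_hom_dQ_map[OF assms(1)] assms(2)]
  by (simp add: dQ_map_id[OF assms(2)])

text \<open>On free chains the inclusion is the identity and the boundary formula does not mention
  the space, so both composites take \<open>c\<close> to \<open>dQ_boundary n c\<close>.\<close>

lemma dC_map_boundary:
  assumes "A \<subseteq> X" "z \<in> carrier (dC \<kappa> n A)"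
  shows "dC_boundary \<kappa> n X (dC_map \<kappa> n X (\<lambda>x. x) z)
    = dC_map \<kappa> (n - 1) X (\<lambda>x. x) (dC_boundary \<kappa> n A z)"
  unfolding dC_boundary_def dC_map_def
proof (rule quot_map_square[OF quot_hom_dQ_map[OF assms(1)] quot_hom_dQ_boundary
      quot_hom_dQ_boundary quot_hom_dQ_map[OF assms(1)]])
  show "z \<in> carrier (dQ \<kappa> n A Mod dD \<kappa> n A)" using assms(2) by (simp add: dC_def)
  fix c assume c: "c \<in> carrier (dQ \<kappa> n A)"
  then have "dQ_boundary n c \<in> carrier (dQ \<kappa> (n - 1) A)"
    by (rule quot_hom.h_closed[OF quot_hom_dQ_boundary])
  then show "dQ_boundary n (dQ_map n (\<lambda>x. x) c) = dQ_map (n - 1) (\<lambda>x. x) (dQ_boundary n c)"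
    using c by (simp add: dQ_map_id)
qed

lemma dC_map_trans:
  assumes "A \<subseteq> B" "B \<subseteq> X" "z \<in> carrier (dC \<kappa> n A)"
  shows "dC_map \<kappa> n X (\<lambda>x. x) (dC_map \<kappa> n B (\<lambda>x. x) z) = dC_map \<kappa> n X (\<lambda>x. x) z"
proof -
  obtain c where c: "c \<in> carrier (dQ \<kappa> n A)" "z = dD \<kappa> n A #>\<^bsub>dQ \<kappa> n A\<^esub> c"
    using assms(3) by (auto simp: dC_def carrier_FactGroup)
  then have "c \<in> carrier (dQ \<kappa> n B)"
    using dcubes_mono[OF assms(1), of \<kappa> n] by (auto simp: carrier_dQ)
  then show ?thesis
    using c assms by (simp add: dC_map_coset)
qed

lemma subgroup_dC_sub: "A \<subseteq> X \<Longrightarrow> subgroup (dC_sub \<kappa> n X A) (dC \<kappa> n X)"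
  unfolding dC_sub_def
  by (intro group_hom.img_is_subgroup)
    (simp add: group_hom_def group_hom_axioms_def dC_map_hom comm_group.axioms comm_group_dC)

lemma comm_group_dC_rel: "A \<subseteq> X \<Longrightarrow> comm_group (dC_rel \<kappa> n X A)"
  unfolding dC_rel_def by (intro comm_group.abelian_FactGroup comm_group_dC subgroup_dC_sub)

text \<open>The inclusion commutes with the boundary, so a chain coming from \<open>A\<close> has a
  boundary coming from \<open>A\<close>. Hence the relative boundary is well defined.\<close>

lemma quot_hom_dC_boundary:
  assumes "A \<subseteq> X"
  shows "quot_hom (dC \<kappa> n X) (dC \<kappa> (n - 1) X) (dC_sub \<kappa> n X A) (dC_sub \<kappa> (n - 1) X A)
    (dC_boundary \<kappa> n X)"
proof (intro quot_hom.intro quot_hom_axioms.intro comm_group_dC subgroup_dC_sub dC_boundary_hom assms)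
  show "dC_boundary \<kappa> n X ` dC_sub \<kappa> n X A \<subseteq> dC_sub \<kappa> (n - 1) X A"
    unfolding dC_sub_def
    using dC_map_boundary[OF assms, of _ \<kappa> n] hom_in_carrier[OF dC_boundary_hom[of \<kappa> n A]] by auto
qed

lemma quot_hom_dC_map:
  assumes "C \<subseteq> B" "C \<subseteq> A" "A \<subseteq> X" "B \<subseteq> X"
  shows "quot_hom (dC \<kappa> n B) (dC \<kappa> n X) (dC_sub \<kappa> n B C) (dC_sub \<kappa> n X A) (dC_map \<kappa> n X (\<lambda>x. x))"
proof (intro quot_hom.intro quot_hom_axioms.intro comm_group_dC subgroup_dC_sub dC_map_hom assms)
  show "dC_map \<kappa> n X (\<lambda>x. x) ` dC_sub \<kappa> n B C \<subseteq> dC_sub \<kappa> n X A"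
  proof
    fix w assume "w \<in> dC_map \<kappa> n X (\<lambda>x. x) ` dC_sub \<kappa> n B C"
    then obtain z where z: "z \<in> carrier (dC \<kappa> n C)"
      "w = dC_map \<kappa> n X (\<lambda>x. x) (dC_map \<kappa> n B (\<lambda>x. x) z)"
      by (auto simp: dC_sub_def)
    \<comment> \<open>The routes from \<open>C\<close> to \<open>X\<close> through \<open>B\<close>
      and through \<open>A\<close> both agree with the direct inclusion.\<close>
    have "w = dC_map \<kappa> n X (\<lambda>x. x) (dC_map \<kappa> n A (\<lambda>x. x) z)"
      using assms z by (simp add: dC_map_trans)
    then show "w \<in> dC_sub \<kappa> n X A"
      using hom_in_carrier[OF dC_map_hom[OF assms(2)] z(1)] by (auto simp: dC_sub_def)
  qed
qed

lemma dC_rel_boundary_hom: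
  "A \<subseteq> X \<Longrightarrow> dC_rel_boundary \<kappa> n X A \<in> hom (dC_rel \<kappa> n X A) (dC_rel \<kappa> (n - 1) X A)"
  unfolding dC_rel_boundary_def dC_rel_def
  by (intro quot_hom.quot_map_hom quot_hom_dC_boundary)

lemma dC_rel_map_boundary:
  assumes "C \<subseteq> B" "C \<subseteq> A" "A \<subseteq> X" "B \<subseteq> X" "z \<in> carrier (dC_rel \<kappa> n B C)"
  shows "dC_rel_boundary \<kappa> n X A (dC_rel_map \<kappa> n X A (\<lambda>x. x) z)
    = dC_rel_map \<kappa> (n - 1) X A (\<lambda>x. x) (dC_rel_boundary \<kappa> n B C z)"
  unfolding dC_rel_boundary_def dC_rel_map_def
proof (rule quot_map_square[OF quot_hom_dC_map[OF assms(1-4)] quot_hom_dC_boundary[OF assms(3)]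
      quot_hom_dC_boundary[OF assms(1)] quot_hom_dC_map[OF assms(1-4)]])
  show "z \<in> carrier (dC \<kappa> n B Mod dC_sub \<kappa> n B C)"
    using assms(5) by (simp add: dC_rel_def)
qed (rule dC_map_boundary[OF assms(4)])

text \<open>This is the second isomorphism theorem for chains. Cubes in both subsets are cubes in
  \<open>A \<inter> B\<close>, which gives injectivity; the cover splits each chain of
  \<open>X\<close> into a part in \<open>A\<close> and a part in \<open>B\<close>, which gives
  surjectivity.\<close>

lemma dC_rel_map_iso:
  assumes "A \<subseteq> X" "B \<subseteq> X" and cover: "dcubes \<kappa> n X \<subseteq> dcubes \<kappa> n A \<union> dcubes \<kappa> n B"
  shows "dC_rel_map \<kappa> n X A (\<lambda>x. x) \<in> iso (dC_rel \<kappa> n B (A \<inter> B)) (dC_rel \<kappa> n X A)"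
  unfolding dC_rel_map_def dC_rel_def
proof (rule quot_hom.quot_map_iso[OF quot_hom_dC_map])
  fix w assume w: "w \<in> carrier (dC \<kappa> n B)" and "dC_map \<kappa> n X (\<lambda>x. x) w \<in> dC_sub \<kappa> n X A"
  then obtain c a where c: "c \<in> carrier (dQ \<kappa> n B)" "w = dD \<kappa> n B #>\<^bsub>dQ \<kappa> n B\<^esub> c"
    and a: "a \<in> carrier (dQ \<kappa> n A)"
    and eq: "dC_map \<kappa> n X (\<lambda>x. x) w = dC_map \<kappa> n X (\<lambda>x. x) (dD \<kappa> n A #>\<^bsub>dQ \<kappa> n A\<^esub> a)"
    by (auto simp: dC_sub_def dC_def carrier_FactGroup)
  \<comment> \<open>Equal classes in \<open>X\<close> leave a degenerate difference \<open>d\<close>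
    whose cubes may lie outside \<open>B\<close>, so the resulting equation has to be cut down to
    \<open>B\<close> before it says anything about \<open>w\<close>.\<close>
  have "c \<in> dD \<kappa> n X #>\<^bsub>dQ \<kappa> n X\<^esub> c"
    using c(1) dcubes_mono[OF assms(2), of \<kappa> n] subgroup_dD
    by (intro group.rcos_self comm_group.axioms(2) comm_group_dQ) (auto simp: carrier_dQ)
  also have "\<dots> = dD \<kappa> n X #>\<^bsub>dQ \<kappa> n X\<^esub> a"
    using eq c a assms by (simp add: dC_map_coset)
  finally obtain d where d: "d \<in> dD \<kappa> n X" "c = d + a"
    by (auto simp: r_coset_def)
  \<comment> \<open>Discarding the cubes outside \<open>B\<close> fixes \<open>c\<close>, keeps \<open>d\<close> degenerate and moves \<open>a\<close> into \<open>A \<inter> B\<close>.\<close>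
  define r where "r = frag_extend (\<lambda>T. if T \<in> dcubes \<kappa> n B then frag_of T else 0)"
  have keys_r: "Poly_Mapping.keys (r x) \<subseteq> Poly_Mapping.keys x \<inter> dcubes \<kappa> n B" for x
    unfolding r_def by (rule order_trans[OF keys_frag_extend]) (auto split: if_splits)
  have "r c = frag_extend frag_of c"
    using c(1) unfolding r_def by (intro frag_extend_eq) (auto simp: carrier_dQ)
  then have "c = r d + r a"
    using d(2) by (simp add: r_def frag_extend_add flip: frag_expansion)
  moreover have "r d \<in> dD \<kappa> n B"
    using keys_r[of d] d(1) by (auto simp: dD_eq degenerate_cubes_def)
  moreover have ra: "r a \<in> carrier (dQ \<kappa> n (A \<inter> B))"
    using keys_r[of a] a by (auto simp: carrier_dQ simp flip: dcubes_Int)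
  moreover have raB: "r a \<in> carrier (dQ \<kappa> n B)"
    using keys_r[of a] by (auto simp: carrier_dQ)
  ultimately have "c \<in> dD \<kappa> n B #>\<^bsub>dQ \<kappa> n B\<^esub> r a"
    by (auto simp: r_coset_def)
  then have "w = dD \<kappa> n B #>\<^bsub>dQ \<kappa> n B\<^esub> r a"
    using c(2) raB subgroup_dD group.repr_independence[OF comm_group.axioms(2)[OF comm_group_dQ]] by metis
  also have "\<dots> = dC_map \<kappa> n B (\<lambda>x. x) (dD \<kappa> n (A \<inter> B) #>\<^bsub>dQ \<kappa> n (A \<inter> B)\<^esub> r a)"
    using ra by (simp add: dC_map_coset)
  finally show "w \<in> dC_sub \<kappa> n B (A \<inter> B)"
    using ra by (auto simp: dC_sub_def dC_def carrier_FactGroup)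
next
  fix y assume "y \<in> carrier (dC \<kappa> n X)"
  then obtain c where c: "c \<in> carrier (dQ \<kappa> n X)" "y = dD \<kappa> n X #>\<^bsub>dQ \<kappa> n X\<^esub> c"
    by (auto simp: dC_def carrier_FactGroup)
  then have "Poly_Mapping.keys c \<subseteq> dcubes \<kappa> n A \<union> dcubes \<kappa> n B"
    using cover by (auto simp: carrier_dQ)
  \<comment> \<open>The part \<open>a\<close> dies modulo the chains of \<open>A\<close>, so the
    class of \<open>b\<close> is the preimage sought.\<close>
  then obtain a b where ab: "a \<in> carrier (dQ \<kappa> n A)" "b \<in> carrier (dQ \<kappa> n B)" "a + b = c"
    by (rule frag_split) (auto simp: carrier_dQ)
  have abX: "a \<in> carrier (dQ \<kappa> n X)" "b \<in> carrier (dQ \<kappa> n X)"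
    using ab dcubes_mono[OF assms(1), of \<kappa> n] dcubes_mono[OF assms(2), of \<kappa> n] by (auto simp: carrier_dQ)
  interpret normal "dD \<kappa> n X" "dQ \<kappa> n X"
    by (intro comm_group.subgroup_imp_normal comm_group_dQ subgroup_dD)
  have "y = (dD \<kappa> n X #>\<^bsub>dQ \<kappa> n X\<^esub> a) <#>\<^bsub>dQ \<kappa> n X\<^esub> (dD \<kappa> n X #>\<^bsub>dQ \<kappa> n X\<^esub> b)"
    using abX by (simp add: rcos_sum c ab)
  also have "\<dots> = dC_map \<kappa> n X (\<lambda>x. x) (dD \<kappa> n A #>\<^bsub>dQ \<kappa> n A\<^esub> a)
      \<otimes>\<^bsub>dC \<kappa> n X\<^esub> dC_map \<kappa> n X (\<lambda>x. x) (dD \<kappa> n B #>\<^bsub>dQ \<kappa> n B\<^esub> b)"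
    using ab assms by (simp add: dC_map_coset) (simp add: dC_def)
  finally show "\<exists>x\<in>carrier (dC \<kappa> n B). y \<in> dC_sub \<kappa> n X A #>\<^bsub>dC \<kappa> n X\<^esub> dC_map \<kappa> n X (\<lambda>x. x) x"
    using ab by (auto simp: r_coset_def dC_sub_def dC_def carrier_FactGroup)
qed (use assms in auto)

section \<open>Relative homology\<close>

text \<open>Homology in degree \<open>n\<close> sees only the relative chains in degrees
  \<open>n - 1\<close>, \<open>n\<close> and \<open>n + 1\<close>, where the inclusion is an
  isomorphism commuting with the boundary. It therefore matches cycles with cycles and boundaries
  with boundaries.\<close>

lemma dH_map_iso:
  assumes "A \<subseteq> X" "B \<subseteq> X"
    and cover: "\<And>m. m \<le> n + 1 \<Longrightarrow> dcubes \<kappa> m X \<subseteq> dcubes \<kappa> m A \<union> dcubes \<kappa> m B"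
  shows "dH_map \<kappa> n X A (\<lambda>x. x) \<in> iso (dH \<kappa> n B (A \<inter> B)) (dH \<kappa> n X A)"
proof -
  let ?f = "\<lambda>m. dC_rel_map \<kappa> m X A (\<lambda>x. x)"
  let ?B = "\<lambda>m. dC_rel \<kappa> m B (A \<inter> B)" and ?X = "\<lambda>m. dC_rel \<kappa> m X A"
  let ?dB = "\<lambda>m. dC_rel_boundary \<kappa> m B (A \<inter> B)" and ?dX = "\<lambda>m. dC_rel_boundary \<kappa> m X A"
  have iso: "?f m \<in> iso (?B m) (?X m)" if "m \<le> n + 1" for m
    by (intro dC_rel_map_iso assms cover that)
  have surj: "?f m ` carrier (?B m) = carrier (?X m)" if "m \<le> n + 1" for m
    using iso[OF that] by (auto simp: iso_def bij_betw_def)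
  have comm: "?dX m (?f m z) = ?f (m - 1) (?dB m z)" if "z \<in> carrier (?B m)" for m z
    using assms that by (intro dC_rel_map_boundary) auto
  have cgB: "comm_group (?B m)" and cgX: "comm_group (?X m)" for m
    using assms by (auto intro: comm_group_dC_rel)
  have dB: "?dB m \<in> hom (?B m) (?B (m - 1))" for m
    by (rule dC_rel_boundary_hom) simp
  interpret f0: group_hom "?B (n - 1)" "?X (n - 1)" "?f (n - 1)"
    using iso[of "n - 1"] cgB cgX by (auto simp: group_hom_def group_hom_axioms_def iso_def comm_group_def)
  \<comment> \<open>Injectivity in degree \<open>n - 1\<close> pulls a vanishing boundary in
    \<open>(X, A)\<close> back to \<open>(B, A \<inter> B)\<close>.\<close>
  have ker_f0: "?f (n - 1) z = \<one>\<^bsub>?X (n - 1)\<^esub> \<longleftrightarrow> z = \<one>\<^bsub>?B (n - 1)\<^esub>" if "z \<in> carrier (?B (n - 1))" for z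
    using iso[of "n - 1"] that f0.hom_one inj_onD[of "?f (n - 1)" "carrier (?B (n - 1))" z "\<one>\<^bsub>?B (n - 1)\<^esub>"]
    by (auto simp: iso_def bij_betw_def)
  have ker: "?f n ` kernel (?B n) (?B (n - 1)) (?dB n) = kernel (?X n) (?X (n - 1)) (?dX n)"
  proof -
    have "?dX n (?f n z) = \<one>\<^bsub>?X (n - 1)\<^esub> \<longleftrightarrow> ?dB n z = \<one>\<^bsub>?B (n - 1)\<^esub>" if "z \<in> carrier (?B n)" for z
      using that by (simp add: comm ker_f0 hom_in_carrier[OF dB])
    then show ?thesis
      unfolding kernel_def surj[of n, simplified, symmetric] by blast
  qed
  \<comment> \<open>Surjectivity in degree \<open>n + 1\<close> replaces each relative chain of
    \<open>(X, A)\<close> by the image of one of \<open>(B, A \<inter> B)\<close>; this is why the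
    cover must reach that degree.\<close>
  have "rel_boundaries \<kappa> n X A = ?dX (n + 1) ` ?f (n + 1) ` carrier (?B (n + 1))"
    by (simp add: rel_boundaries_def surj)
  also have "\<dots> = ?f n ` rel_boundaries \<kappa> n B (A \<inter> B)"
    using comm[of _ "n + 1"] by (simp add: rel_boundaries_def image_image cong: image_cong_simp)
  finally have bound: "?f n ` rel_boundaries \<kappa> n B (A \<inter> B) = rel_boundaries \<kappa> n X A" by simp
  have "subgroup (rel_boundaries \<kappa> n B (A \<inter> B)) (?B n)"
    unfolding rel_boundaries_def using dB[of "n + 1"] cgB
    by (intro group_hom.img_is_subgroup) (simp add: group_hom_def group_hom_axioms_def comm_group_def)
  then show ?thesis
    unfolding dH_map_def dH_def rel_cycles_def using iso[of n] ker bound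
    by (intro quot_map_iso_restrict cgB cgX) (auto simp: kernel_def)
qed

theorem theorem5p6:
  fixes d l :: nat and X :: "int list set"
  assumes "digital_image d l X"
  shows "(\<forall>A W. A \<subseteq> X \<longrightarrow> W \<subseteq> X \<longrightarrow>
            dCl (c_adj l) X W \<subseteq> dInt (c_adj l) X A \<longrightarrow>
            (\<forall>n :: int. n < 2 \<longrightarrow>
               dH_map (c_adj l) n X A (\<lambda>x. x)
                 \<in> iso (dH (c_adj l) n (X - W) (A - W)) (dH (c_adj l) n X A)))
       \<and> (\<forall>A B. A \<subseteq> X \<longrightarrow> B \<subseteq> X \<longrightarrow>
            X = dInt (c_adj l) X A \<union> dInt (c_adj l) X B \<longrightarrow>
            (\<forall>n :: int. n < 2 \<longrightarrow>
               dH_map (c_adj l) n X A (\<lambda>x. x)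
                 \<in> iso (dH (c_adj l) n B (A \<inter> B)) (dH (c_adj l) n X A)))"
proof -
  have part2: "dH_map (c_adj l) n X A (\<lambda>x. x)
      \<in> iso (dH (c_adj l) n B (A \<inter> B)) (dH (c_adj l) n X A)"
    if "A \<subseteq> X" "B \<subseteq> X" "X = dInt (c_adj l) X A \<union> dInt (c_adj l) X B" "n < 2" for A B n
    \<comment> \<open>From \<open>n < 2\<close> the degrees up to \<open>n + 1\<close> are at most
      2, exactly the range of \<open>dcubes_cover\<close>.\<close>
    using that by (intro dH_map_iso subsetI dcubes_cover[of "c_adj l"]) (auto intro: c_adj_sym)
  have part1: "dH_map (c_adj l) n X A (\<lambda>x. x)
      \<in> iso (dH (c_adj l) n (X - W) (A - W)) (dH (c_adj l) n X A)"
    if "A \<subseteq> X" "W \<subseteq> X" "dCl (c_adj l) X W \<subseteq> dInt (c_adj l) X A" "n < 2" for A W n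
  proof -
    \<comment> \<open>A point outside the closure of \<open>W\<close> has a neighbourhood missing
      \<open>W\<close>, so it is interior to \<open>X - W\<close>; the points of the closure are
      interior to \<open>A\<close> by hypothesis.\<close>
    have "X = dInt (c_adj l) X A \<union> dInt (c_adj l) X (X - W)"
      using that by (auto simp: dInt_def dCl_def dnbhd_def)
    moreover have "A \<inter> (X - W) = A - W" using that by auto
    ultimately show ?thesis using part2[of A "X - W" n] that by auto
  qed
  show ?thesis using part1 part2 by blast
qed

end
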